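(* Let $Q$ be a constellation with range. Then its canonical extension $C=C(Q)$ is an IS-category in which $I_C=C_I(Q)$ and $S_C=C_S(Q)$. Moreover, for $a=(s,e)\in C(Q)$ we have $s_a=(s,R(s))$ and $i_a=(R(s),e)$.
   Context: Categories (object-free). A category is a class $C$ with a partial binary operation $\circ$ such that: (C1) $x\circ(y\circ z)$ exists iff $(x\circ y)\circ z$ exists, and then they are equal; (C2) if $x\circ y$ and $y\circ z$ exist then so does $x\circ(y\circ z)$; (C3) for each $x$ there are identities $e,f$ with $e\circ x$ and $x\circ f$ existing (an identity is an $e$ with $x\circ e=x$ whenever $x\circ e$ exists and $e\circ x=x$ whenever $e\circ x$ exists). These $e,f$ are unique and written $D(x)=e$, $R(x)=f$; $x\circ y$ exists iff $R(x)=D(y)$. $D(C)=\{D(x)\mid x\in C\}$. IS-categories. An IS-category is a category $C$ with subcategories $I_C$ and $S_C$, each containing $D(C)$, such that (IS1) for $e,f\in D(C)$ there is at most one $i\in I_C$ such that either ($D(i)=e$ and $R(i)=f$) or ($D(i)=f$ and $R(i)=e$); (IS2) for all $a\in C$ there are unique $s_a\in S_C$ and $i_a\in I_C$ with $a=s_a\circ i_a$. Constellations. A constellation is a class $Q$ with a partial binary operation $\cdot$ such that: (Q1) if $x\cdot(y\cdot z)$ exists then $(x\cdot y)\cdot z$ exists and they are equal; (Q2) if $x\cdot y$ and $y\cdot z$ exist then so does $x\cdot(y\cdot z)$; (Q3) for each $x\in Q$ there is a unique right identity $e$ with $e\cdot x=x$ (a right identity is an $e$ with $x\cdot e=x$ whenever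 $x\cdot e$ exists); put $D(x)=e$, $D(Q)=\{D(x)\mid x\in Q\}$. For $e,f\in D(Q)$, $e\leq f$ iff $e\cdot f$ exists. A constellation with range is a constellation in which for each $s$ the set $\{e\in D(Q)\mid s\cdot e\text{ exists, and for all }f\in D(Q),\ s\cdot f\text{ exists implies }e\leq f\}$ has exactly one element, $R(s)$, and $R(R(s)\cdot t)=R(s\cdot t)$ whenever $s\cdot t$ exists. Canonical extension. $C(Q)=\{(s,e)\mid s\in Q,\ e\in D(Q),\ s\cdot e\text{ exists}\}$ is the category with $D((s,e))=(D(s),D(s))$, $R((s,e))=(e,e)$ and $(s,e)\circ(t,f)=(s\cdot t,f)$ when $e=D(t)$. $C_I(Q)=\{(e,f)\mid e,f\in D(Q),\ e\cdot f\text{ exists}\}$ and $C_S(Q)=\{(s,R(s))\mid s\in Q\}$. *)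

theory Defs
  imports Main
begin

text \<open>
  A partial binary operation on a carrier set is a function into the option type, with \<open>None\<close>
  meaning that the product does not exist. Values outside the carrier are irrelevant: everything
  below is relativised to it.
\<close>

locale partial_operation =
  fixes Q :: "'a set" and mult :: "'a \<Rightarrow> 'a \<Rightarrow> 'a option" (infixl "\<cdot>" 70)
  assumes closed: "\<lbrakk>x \<in> Q; y \<in> Q; x \<cdot> y = Some z\<rbrakk> \<Longrightarrow> z \<in> Q"
begin

text \<open>The products \<open>x(yz)\<close> and \<open>(xy)z\<close>; each exists iff both products involved exist.\<close>

definition right_nested :: "'a \<Rightarrow> 'a \<Rightarrow> 'a \<Rightarrow> 'a option" where
  "right_nested x y z = Option.bind (y \<cdot> z) (\<lambda>w. x \<cdot> w)"

definition left_nested :: "'a \<Rightarrow> 'a \<Rightarrow> 'a \<Rightarrow> 'a option" where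
  "left_nested x y z = Option.bind (x \<cdot> y) (\<lambda>w. w \<cdot> z)"

definition right_identity :: "'a \<Rightarrow> bool" where
  "right_identity e \<longleftrightarrow> e \<in> Q \<and> (\<forall>x\<in>Q. x \<cdot> e \<noteq> None \<longrightarrow> x \<cdot> e = Some x)"

definition left_identity :: "'a \<Rightarrow> bool" where
  "left_identity e \<longleftrightarrow> e \<in> Q \<and> (\<forall>x\<in>Q. e \<cdot> x \<noteq> None \<longrightarrow> e \<cdot> x = Some x)"

definition identity :: "'a \<Rightarrow> bool" where
  "identity e \<longleftrightarrow> right_identity e \<and> left_identity e"

end

locale category = partial_operation C comp
  for C :: "'a set" and comp :: "'a \<Rightarrow> 'a \<Rightarrow> 'a option" (infixl "\<odot>" 70) +
  assumes C1_ex: "\<lbrakk>x \<in> C; y \<in> C; z \<in> C\<rbrakk> \<Longrightarrow>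
      right_nested x y z \<noteq> None \<longleftrightarrow> left_nested x y z \<noteq> None"
    and C1_eq: "\<lbrakk>x \<in> C; y \<in> C; z \<in> C; right_nested x y z \<noteq> None\<rbrakk> \<Longrightarrow>
      right_nested x y z = left_nested x y z"
    and C2: "\<lbrakk>x \<in> C; y \<in> C; z \<in> C; x \<odot> y \<noteq> None; y \<odot> z \<noteq> None\<rbrakk> \<Longrightarrow>
      right_nested x y z \<noteq> None"
    and C3: "x \<in> C \<Longrightarrow> \<exists>e f. identity e \<and> identity f \<and> e \<odot> x \<noteq> None \<and> x \<odot> f \<noteq> None"
begin

definition D :: "'a \<Rightarrow> 'a" where
  "D x = (THE e. identity e \<and> e \<odot> x \<noteq> None)"

definition R :: "'a \<Rightarrow> 'a" where
  "R x = (THE f. identity f \<and> x \<odot> f \<noteq> None)"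

definition D_set :: "'a set" where
  "D_set = D ` C"

definition subcategory :: "'a set \<Rightarrow> bool" where
  "subcategory B \<longleftrightarrow> B \<subseteq> C
     \<and> (\<forall>x\<in>B. \<forall>y\<in>B. \<forall>z. x \<odot> y = Some z \<longrightarrow> z \<in> B)
     \<and> (\<forall>x\<in>B. D x \<in> B \<and> R x \<in> B)"

end

locale IS_category = category C comp
  for C :: "'a set" and comp :: "'a \<Rightarrow> 'a \<Rightarrow> 'a option" (infixl "\<odot>" 70) +
  fixes I :: "'a set" and S :: "'a set"
  assumes I_subcategory: "subcategory I" and I_contains: "D_set \<subseteq> I"
    and S_subcategory: "subcategory S" and S_contains: "D_set \<subseteq> S"
    and IS1: "\<lbrakk>e \<in> D_set; f \<in> D_set\<rbrakk> \<Longrightarrow>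
      \<exists>\<^sub>\<le>\<^sub>1i. i \<in> I \<and> ((D i = e \<and> R i = f) \<or> (D i = f \<and> R i = e))"
    and IS2: "a \<in> C \<Longrightarrow> \<exists>!p. p \<in> S \<times> I \<and> fst p \<odot> snd p = Some a"
begin

definition factorisation :: "'a \<Rightarrow> 'a \<times> 'a" where
  "factorisation a = (THE p. p \<in> S \<times> I \<and> fst p \<odot> snd p = Some a)"

definition S_part :: "'a \<Rightarrow> 'a" where
  "S_part a = fst (factorisation a)"

definition I_part :: "'a \<Rightarrow> 'a" where
  "I_part a = snd (factorisation a)"

end

locale constellation = partial_operation Q mult
  for Q :: "'a set" and mult :: "'a \<Rightarrow> 'a \<Rightarrow> 'a option" (infixl "\<cdot>" 70) +
  assumes Q1: "\<lbrakk>x \<in> Q; y \<in> Q; z \<in> Q; right_nested x y z \<noteq> None\<rbrakk> \<Longrightarrow>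
      left_nested x y z = right_nested x y z"
    and Q2: "\<lbrakk>x \<in> Q; y \<in> Q; z \<in> Q; x \<cdot> y \<noteq> None; y \<cdot> z \<noteq> None\<rbrakk> \<Longrightarrow>
      right_nested x y z \<noteq> None"
    and Q3: "x \<in> Q \<Longrightarrow> \<exists>!e. right_identity e \<and> e \<cdot> x = Some x"
begin

definition D :: "'a \<Rightarrow> 'a" where
  "D x = (THE e. right_identity e \<and> e \<cdot> x = Some x)"

definition D_set :: "'a set" where
  "D_set = D ` Q"

definition leq :: "'a \<Rightarrow> 'a \<Rightarrow> bool" where
  "leq e f \<longleftrightarrow> e \<cdot> f \<noteq> None"

definition range_set :: "'a \<Rightarrow> 'a set" where
  "range_set s = {e \<in> D_set. s \<cdot> e \<noteq> None \<and> (\<forall>f\<in>D_set. s \<cdot> f \<noteq> None \<longrightarrow> leq e f)}"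

definition R :: "'a \<Rightarrow> 'a" where
  "R s = (THE e. e \<in> range_set s)"

definition can_ext :: "('a \<times> 'a) set" where
  "can_ext = {(s, e). s \<in> Q \<and> e \<in> D_set \<and> s \<cdot> e \<noteq> None}"

text \<open>
  On the carrier, \<open>e = D t\<close> already forces the product of \<open>s\<close> and \<open>t\<close> to exist, so there
  \<open>can_comp (s, e) (t, f)\<close> exists exactly when \<open>e = D t\<close>.
\<close>

definition can_comp :: "'a \<times> 'a \<Rightarrow> 'a \<times> 'a \<Rightarrow> ('a \<times> 'a) option" where
  "can_comp = (\<lambda>(s, e) (t, f). if e = D t then map_option (\<lambda>u. (u, f)) (s \<cdot> t) else None)"

definition can_I :: "('a \<times> 'a) set" where
  "can_I = {(e, f). e \<in> D_set \<and> f \<in> D_set \<and> e \<cdot> f \<noteq> None}"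

definition can_S :: "('a \<times> 'a) set" where
  "can_S = {(s, R s) | s. s \<in> Q}"

end

locale constellation_with_range = constellation Q mult
  for Q :: "'a set" and mult :: "'a \<Rightarrow> 'a \<Rightarrow> 'a option" (infixl "\<cdot>" 70) +
  assumes range_unique: "s \<in> Q \<Longrightarrow> \<exists>!e. e \<in> range_set s"
    and range_cong: "\<lbrakk>s \<in> Q; t \<in> Q; s \<cdot> t = Some v\<rbrakk> \<Longrightarrow> \<exists>u. R s \<cdot> t = Some u \<and> R u = R v"

end

theory Submission
  imports Defs
begin

text \<open>
  An element \<open>(s, e)\<close> of the canonical extension factors as \<open>(s, R s) \<circ> (R s, e)\<close>. The
  factorisation is unique because an element of \<open>C\<^sub>S\<close> is determined by its first component and
  composing it with an element of \<open>C\<^sub>I\<close> changes only the second. In a general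
  constellation the relation \<open>\<le>\<close> on projections is only a quasi-order; uniqueness of ranges makes
  it antisymmetric, which is what (IS1) asks for.
\<close>

context constellation
begin

section \<open>Projections and products in a constellation\<close>

lemma D_char:
  assumes "x \<in> Q"
  shows "right_identity (D x)" "D x \<cdot> x = Some x"
  using theI'[OF Q3[OF assms]] by (auto simp: D_def)

lemma D_equality: "\<lbrakk>x \<in> Q; right_identity e; e \<cdot> x = Some x\<rbrakk> \<Longrightarrow> D x = e"
  using D_char Q3 by blast

lemma D_set_right_identity: "e \<in> D_set \<Longrightarrow> right_identity e"
  by (auto simp: D_set_def D_char)

lemma D_set_closed: "e \<in> D_set \<Longrightarrow> e \<in> Q"
  using D_set_right_identity by (auto simp: right_identity_def)

lemma D_in_D_set [simp]: "x \<in> Q \<Longrightarrow> D x \<in> D_set"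
  by (auto simp: D_set_def)

lemma mult_D_set: "\<lbrakk>x \<in> Q; e \<in> D_set; x \<cdot> e \<noteq> None\<rbrakk> \<Longrightarrow> x \<cdot> e = Some x"
  using D_set_right_identity by (auto simp: right_identity_def)

text \<open>The product \<open>D e \<cdot> e\<close> is \<open>e\<close> by the choice of
  \<open>D e\<close>, and is \<open>D e\<close> because \<open>e\<close> is a right
  identity.\<close>

lemma D_of_D_set: "e \<in> D_set \<Longrightarrow> D e = e"
  using D_char(2)[of e] mult_D_set[of "D e" e] D_char(1)[of e] D_set_closed[of e]
  by (simp add: right_identity_def)

lemma D_set_idem: "e \<in> D_set \<Longrightarrow> e \<cdot> e = Some e"
  using D_char(2)[of e] by (simp add: D_of_D_set D_set_closed)

lemma assoc:
  assumes "x \<in> Q" "y \<in> Q" "z \<in> Q" "y \<cdot> z = Some w" "x \<cdot> w = Some v"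
  shows "\<exists>u. x \<cdot> y = Some u \<and> u \<cdot> z = Some v"
  using Q1[OF assms(1-3)] assms(4,5)
  by (auto simp: right_nested_def left_nested_def bind_eq_Some_conv)

text \<open>The form in which \<open>Q1\<close> and \<open>Q2\<close> are mostly applied below:
  \<open>Q2\<close> supplies the right-nested product, and \<open>Q1\<close> then the left-nested
  one with the same value.\<close>

lemma mult_ex:
  assumes "x \<in> Q" "y \<in> Q" "z \<in> Q" "x \<cdot> y = Some u" "y \<cdot> z = Some w"
  shows "\<exists>v. x \<cdot> w = Some v \<and> u \<cdot> z = Some v"
  using Q2[OF assms(1-3)] assoc[OF assms(1-3)] assms(4,5)
  by (auto simp: right_nested_def)

text \<open>Write \<open>y\<close> as \<open>D y \<cdot> y\<close>: \<open>Q1\<close> splits off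
  \<open>x \<cdot> D y\<close> from \<open>x \<cdot> y\<close>, and \<open>Q2\<close> recovers
  \<open>x \<cdot> y\<close> from it.\<close>

lemma mult_ex_iff_D:
  assumes "x \<in> Q" "y \<in> Q"
  shows "x \<cdot> y \<noteq> None \<longleftrightarrow> x \<cdot> D y \<noteq> None"
  using assoc[of x "D y" y y] mult_ex[of x "D y" y _ y] D_char[OF assms(2)] assms
  by (auto simp: right_identity_def)

text \<open>Since \<open>D x \<cdot> x\<close> is \<open>x\<close>, rebracketing shows that the
  right identity \<open>D x\<close> also fixes \<open>v\<close> from the left; \<open>Q3\<close>
  makes such a right identity unique.\<close>

lemma D_mult:
  assumes "x \<in> Q" "y \<in> Q" "x \<cdot> y = Some v"
  shows "D v = D x"
  using mult_ex[of "D x" x y x v] D_char[OF assms(1)] assms closed[OF assms]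
  by (intro D_equality) (auto simp: right_identity_def)

lemma leq_trans:
  assumes "x \<in> Q" "e \<in> D_set" "f \<in> D_set" "x \<cdot> e \<noteq> None" "leq e f"
  shows "x \<cdot> f \<noteq> None"
  using mult_ex[of x e f x e] mult_D_set assms D_set_closed by (force simp: leq_def)

section \<open>The canonical extension as a category\<close>

lemma can_ext_iff: "(s, e) \<in> can_ext \<longleftrightarrow> s \<in> Q \<and> e \<in> D_set \<and> s \<cdot> e = Some s"
  using mult_D_set by (auto simp: can_ext_def)

lemma can_I_iff: "(e, f) \<in> can_I \<longleftrightarrow> e \<in> D_set \<and> f \<in> D_set \<and> e \<cdot> f = Some e"
  using mult_D_set D_set_closed by (auto simp: can_I_def)

lemma can_comp_eq_Some_iff:
  "can_comp (s, e) (t, f) = Some p \<longleftrightarrow> e = D t \<and> (\<exists>u. s \<cdot> t = Some u \<and> p = (u, f))"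
  by (auto simp: can_comp_def)

lemma can_comp_ex_iff:
  assumes "(s, e) \<in> can_ext" "(t, f) \<in> can_ext"
  shows "can_comp (s, e) (t, f) \<noteq> None \<longleftrightarrow> e = D t"
  using assms mult_ex_iff_D[of s t] by (auto simp: can_comp_def can_ext_iff)

sublocale can: partial_operation can_ext can_comp
proof
  fix x y z assume "x \<in> can_ext" "y \<in> can_ext" "can_comp x y = Some z"
  moreover obtain s e t f v h where xyz: "x = (s, e)" "y = (t, f)" "z = (v, h)"
    by (metis surj_pair)
  \<comment> \<open>The composite is \<open>(v, f)\<close>; it stays in the carrier because
    \<open>t \<cdot> f = t\<close> rebrackets to \<open>v \<cdot> f = v\<close>.\<close>
  ultimately show "z \<in> can_ext"
    using mult_ex[of s t f v t] closed[of s t v]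
    by (auto simp: can_ext_iff can_comp_eq_Some_iff D_set_closed)
qed

lemma can_identity:
  assumes "e \<in> D_set"
  shows "can.identity (e, e)"
  using assms
  by (auto simp: can.identity_def can.right_identity_def can.left_identity_def can_ext_iff
      D_set_idem D_set_closed can_comp_eq_Some_iff D_of_D_set D_char)

lemma can_comp_D_left: "(s, e) \<in> can_ext \<Longrightarrow> can_comp (D s, D s) (s, e) = Some (s, e)"
  by (auto simp: can_comp_eq_Some_iff can_ext_iff D_char)

lemma can_comp_D_right: "(s, e) \<in> can_ext \<Longrightarrow> can_comp (s, e) (e, e) = Some (s, e)"
  by (auto simp: can_comp_eq_Some_iff can_ext_iff D_of_D_set)

text \<open>If \<open>p = (s, e)\<close> is an identity, composing \<open>(D s, D s)\<close> with it
  gives \<open>p\<close> by \<open>can_comp_D_left\<close>, but also \<open>(D s, D s)\<close>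
  because \<open>p\<close> is a right identity.\<close>

lemma can_identity_iff: "can.identity p \<longleftrightarrow> (\<exists>e\<in>D_set. p = (e, e))"
proof
  assume p: "can.identity p"
  obtain s e where [simp]: "p = (s, e)" by (cases p)
  have se: "(s, e) \<in> can_ext"
    using p by (simp add: can.identity_def can.right_identity_def)
  then have D: "D s \<in> D_set" by (simp add: can_ext_iff)
  then have "(D s, D s) \<in> can_ext" by (simp add: can_ext_iff D_set_idem D_set_closed)
  then have "can_comp (D s, D s) p = Some (D s, D s)"
    using p can_comp_D_left[OF se] unfolding can.identity_def can.right_identity_def by simp
  then have "p = (D s, D s)" using can_comp_D_left[OF se] by simp
  with D show "\<exists>e\<in>D_set. p = (e, e)" by blast
qed (auto simp: can_identity)

lemma can_nested_eq:
  assumes "x \<in> can_ext" "y \<in> can_ext" "z \<in> can_ext"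
    and "can_comp x y = Some v" "can_comp y z = Some w"
  shows "can_comp x w = can_comp v z" "can_comp x w \<noteq> None"
proof -
  obtain s e t f u g where xyz: "x = (s, e)" "y = (t, f)" "z = (u, g)"
    by (metis surj_pair)
  obtain v' w' where v: "e = D t" "s \<cdot> t = Some v'" "v = (v', f)"
    and w: "f = D u" "t \<cdot> u = Some w'" "w = (w', g)"
    using assms(4,5) by (auto simp: xyz can_comp_eq_Some_iff)
  have Q: "s \<in> Q" "t \<in> Q" "u \<in> Q" using assms(1-3) by (auto simp: xyz can_ext_iff)
  show "can_comp x w = can_comp v z" "can_comp x w \<noteq> None"
    \<comment> \<open>\<open>D_mult\<close> gives \<open>D w' = D t = e\<close>, so the
      composability test for \<open>x\<close> and \<open>w\<close> succeeds.\<close>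
    using mult_ex[OF Q v(2) w(2)] D_mult[OF Q(2,3) w(2)]
    by (auto simp: xyz v w can_comp_def)
qed

text \<open>Composability with \<open>x\<close> on the left depends only on the domain of the first
  component, which \<open>D_mult\<close> shows to be the same for \<open>y\<close> and
  \<open>w\<close>.\<close>

lemma can_comp_ex_right:
  assumes "x \<in> can_ext" "y \<in> can_ext" "z \<in> can_ext" "can_comp y z = Some w"
  shows "can_comp x w \<noteq> None \<longleftrightarrow> can_comp x y \<noteq> None"
proof -
  obtain s e t f u g w' h where xyz: "x = (s, e)" "y = (t, f)" "z = (u, g)" "w = (w', h)"
    by (metis surj_pair)
  have "D w' = D t"
    using assms D_mult[of t u w'] by (auto simp: xyz can_ext_iff can_comp_eq_Some_iff)
  then show ?thesis
    using assms can.closed[OF assms(2-4)] by (simp add: xyz can_comp_ex_iff del: not_None_eq)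
qed

text \<open>Composition keeps the second component of \<open>y\<close>, and composability with
  \<open>z\<close> on the right depends on nothing else.\<close>

lemma can_comp_ex_left:
  assumes "x \<in> can_ext" "y \<in> can_ext" "z \<in> can_ext" "can_comp x y = Some v"
  shows "can_comp v z \<noteq> None \<longleftrightarrow> can_comp y z \<noteq> None"
  using assms can.closed[OF assms(1,2,4)]
  by (cases x; cases y; cases z; cases v)
    (auto simp: can_comp_ex_iff can_comp_eq_Some_iff simp del: not_None_eq)

sublocale can: category can_ext can_comp
proof
  fix x y z assume xyz: "x \<in> can_ext" "y \<in> can_ext" "z \<in> can_ext"
  \<comment> \<open>If an inner product is missing, the last two facts make both nested products
    undefined; if both inner products exist, \<open>can_nested_eq\<close> applies.\<close>
  note facts = can_nested_eq[OF xyz] can_comp_ex_left[OF xyz] can_comp_ex_right[OF xyz]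
  show ex: "can.right_nested x y z \<noteq> None \<longleftrightarrow> can.left_nested x y z \<noteq> None"
    using facts unfolding can.right_nested_def can.left_nested_def
    by (cases "can_comp x y"; cases "can_comp y z") auto
  show "can.right_nested x y z = can.left_nested x y z" if "can.right_nested x y z \<noteq> None"
    using that facts unfolding can.right_nested_def can.left_nested_def
    by (cases "can_comp x y"; cases "can_comp y z") auto
  show "can.right_nested x y z \<noteq> None" if "can_comp x y \<noteq> None" "can_comp y z \<noteq> None"
    using that facts unfolding can.right_nested_def by auto
next
  fix x assume "x \<in> can_ext"
  then show "\<exists>e f. can.identity e \<and> can.identity f \<and> can_comp e x \<noteq> None \<and> can_comp x f \<noteq> None"
    by (cases x) (metis can_comp_D_left can_comp_D_right can_identity can_ext_iff D_in_D_set
        option.distinct(1))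
qed

lemma can_D:
  assumes "(s, e) \<in> can_ext"
  shows "can.D (s, e) = (D s, D s)"
  unfolding can.D_def
proof (rule the_equality)
  show "can.identity (D s, D s) \<and> can_comp (D s, D s) (s, e) \<noteq> None"
    using assms can_comp_D_left can_identity by (simp add: can_ext_iff)
qed (auto simp: can_identity_iff can_comp_eq_Some_iff)

lemma can_R:
  assumes "(s, e) \<in> can_ext"
  shows "can.R (s, e) = (e, e)"
  unfolding can.R_def
proof (rule the_equality)
  show "can.identity (e, e) \<and> can_comp (s, e) (e, e) \<noteq> None"
    using assms can_comp_D_right can_identity by (simp add: can_ext_iff)
qed (auto simp: can_identity_iff can_comp_eq_Some_iff D_of_D_set)

lemma can_D_set: "can.D_set = {(e, e) | e. e \<in> D_set}"
proof
  show "can.D_set \<subseteq> {(e, e) | e. e \<in> D_set}"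
    unfolding can.D_set_def by (auto simp: can_D can_ext_iff)
  have "(e, e) \<in> can.D_set" if "e \<in> D_set" for e
  proof -
    have e: "(e, e) \<in> can_ext"
      using that by (simp add: can_ext_iff D_set_idem D_set_closed)
    then have "can.D (e, e) = (e, e)" using that by (simp add: can_D D_of_D_set)
    with e show ?thesis unfolding can.D_set_def by (metis imageI)
  qed
  then show "{(e, e) | e. e \<in> D_set} \<subseteq> can.D_set" by blast
qed

section \<open>The subcategory of comparable projections\<close>

lemma can_I_subset: "can_I \<subseteq> can_ext"
  by (auto simp: can_I_iff can_ext_iff D_set_closed)

lemma can_I_subcategory: "can.subcategory can_I"
  unfolding can.subcategory_def
proof (intro conjI ballI allI impI can_I_subset)
  fix x y z assume "x \<in> can_I" "y \<in> can_I" "can_comp x y = Some z"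
  moreover obtain e f e' g h k where "x = (e, f)" "y = (e', g)" "z = (h, k)"
    by (metis surj_pair)
  \<comment> \<open>Composing \<open>(e, f)\<close> with \<open>(f, g)\<close> yields
    \<open>(e, g)\<close>, so closure is transitivity of \<open>leq\<close>.\<close>
  ultimately show "z \<in> can_I"
    using mult_ex[of e f g e f] by (auto simp: can_I_iff can_comp_eq_Some_iff D_of_D_set D_set_closed)
next
  fix x assume "x \<in> can_I"
  moreover from this have "x \<in> can_ext" using can_I_subset by blast
  ultimately show "can.D x \<in> can_I" "can.R x \<in> can_I"
    by (cases x; simp add: can_D can_R can_I_iff D_of_D_set D_set_idem)+
qed

end

section \<open>Ranges and antisymmetry of the order\<close>

context constellation_with_range
begin

lemma R_in_range_set: "s \<in> Q \<Longrightarrow> R s \<in> range_set s"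
  using theI'[OF range_unique] by (simp add: R_def)

lemma R_equality: "\<lbrakk>s \<in> Q; e \<in> range_set s\<rbrakk> \<Longrightarrow> R s = e"
  using R_in_range_set range_unique by blast

lemma R_in_D_set [simp]: "s \<in> Q \<Longrightarrow> R s \<in> D_set"
  using R_in_range_set by (simp add: range_set_def)

lemma mult_R: "s \<in> Q \<Longrightarrow> s \<cdot> R s = Some s"
  using R_in_range_set mult_D_set by (simp add: range_set_def)

lemma R_leq: "\<lbrakk>s \<in> Q; f \<in> D_set; s \<cdot> f \<noteq> None\<rbrakk> \<Longrightarrow> leq (R s) f"
  using R_in_range_set by (simp add: range_set_def)

lemma R_of_D_set: "e \<in> D_set \<Longrightarrow> R e = e"
  by (intro R_equality) (auto simp: range_set_def D_set_closed D_set_idem leq_def)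

text \<open>By transitivity, \<open>f\<close> lies below every projection above \<open>e\<close>, so
  \<open>f\<close> is a candidate for the range of \<open>e\<close>; but that range is
  \<open>e\<close> itself.\<close>

lemma leq_antisym:
  assumes "e \<in> D_set" "f \<in> D_set" "leq e f" "leq f e"
  shows "e = f"
proof -
  have "f \<in> range_set e"
    using assms leq_trans[of f e] by (auto simp: range_set_def leq_def D_set_closed)
  then show ?thesis
    using R_equality[of e f] R_of_D_set assms D_set_closed by simp
qed

section \<open>The range subcategory and factorisations\<close>

lemma can_S_iff: "(s, e) \<in> can_S \<longleftrightarrow> s \<in> Q \<and> e = R s"
  by (auto simp: can_S_def)

lemma can_S_subset: "can_S \<subseteq> can_ext"
  by (auto simp: can_S_iff can_ext_iff mult_R)

text \<open>The range congruence replaces \<open>s\<close> by \<open>R s\<close> in the product, and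
  \<open>R s \<cdot> t = D t \<cdot> t = t\<close>. This is what closes \<open>can_S\<close> under
  composition.\<close>

lemma R_mult:
  assumes "s \<in> Q" "t \<in> Q" "R s = D t" "s \<cdot> t = Some v"
  shows "R v = R t"
  using range_cong[OF assms(1,2,4)] assms D_char by auto

lemma can_S_subcategory: "can.subcategory can_S"
  unfolding can.subcategory_def
proof (intro conjI ballI allI impI can_S_subset)
  fix x y z assume "x \<in> can_S" "y \<in> can_S" "can_comp x y = Some z"
  moreover obtain s e t f v h where "x = (s, e)" "y = (t, f)" "z = (v, h)"
    by (metis surj_pair)
  ultimately show "z \<in> can_S"
    using closed[of s t v] R_mult[of s t v] by (auto simp: can_S_iff can_comp_eq_Some_iff)
next
  fix x assume "x \<in> can_S"
  moreover from this have "x \<in> can_ext" using can_S_subset by blast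
  ultimately show "can.D x \<in> can_S" "can.R x \<in> can_S"
    by (cases x; simp add: can_D can_R can_S_iff R_of_D_set D_set_closed)+
qed

text \<open>\<open>R_leq\<close> puts \<open>(R s, e)\<close> in \<open>can_I\<close>. Conversely,
  if the first factor is \<open>(s', R s')\<close>, composability makes the second start at
  \<open>R s'\<close>, and \<open>mult_R\<close> forces \<open>s' = s\<close>. The equivalence
  serves both to prove (IS2) and to evaluate \<open>can.factorisation\<close>.\<close>

lemma can_factorisation_iff:
  assumes "(s, e) \<in> can_ext"
  shows "p \<in> can_S \<times> can_I \<and> can_comp (fst p) (snd p) = Some (s, e)
    \<longleftrightarrow> p = ((s, R s), (R s, e))"
  using assms mult_R R_leq[of s e]
  by (cases p) (auto simp: can_S_iff can_I_def can_comp_eq_Some_iff can_ext_iff D_of_D_set leq_def)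

section \<open>The IS-category structure\<close>

sublocale can: IS_category can_ext can_comp can_I can_S
proof
  show "can.D_set \<subseteq> can_I"
    by (auto simp: can_D_set can_I_iff D_set_idem)
  show "can.D_set \<subseteq> can_S"
    by (auto simp: can_D_set can_S_iff R_of_D_set D_set_closed)
next
  fix e f assume "e \<in> can.D_set" "f \<in> can.D_set"
  have DR: "can.D (a, b) = (a, a)" "can.R (a, b) = (b, b)" if "(a, b) \<in> can_I" for a b
    using that can_I_subset by (auto simp: can_D can_R can_I_iff D_of_D_set subset_iff)
  show "\<exists>\<^sub>\<le>\<^sub>1i. i \<in> can_I \<and> (can.D i = e \<and> can.R i = f \<or> can.D i = f \<and> can.R i = e)"
  proof (rule Uniq_I, goal_cases)
    case (1 i j)
    \<comment> \<open>By \<open>DR\<close> the endpoints determine the pair. If \<open>i\<close> and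
      \<open>j\<close> have opposite orientations, they are \<open>(a, b)\<close> and
      \<open>(b, a)\<close>, and antisymmetry gives \<open>a = b\<close>.\<close>
    then show ?case
      using leq_antisym by (cases i; cases j) (auto simp: DR can_I_iff leq_def)
  qed
next
  fix a assume "a \<in> can_ext"
  then show "\<exists>!p. p \<in> can_S \<times> can_I \<and> can_comp (fst p) (snd p) = Some a"
    by (cases a) (simp add: can_factorisation_iff)
qed (fact can_I_subcategory can_S_subcategory)+

lemma can_factorisation:
  "(s, e) \<in> can_ext \<Longrightarrow> can.factorisation (s, e) = ((s, R s), (R s, e))"
  by (simp add: can.factorisation_def can_factorisation_iff)

end

theorem corollary7p8:
  fixes Q :: "'a set" and mult :: "'a \<Rightarrow> 'a \<Rightarrow> 'a option"
  assumes "constellation_with_range Q mult"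
  shows "IS_category (constellation.can_ext Q mult) (constellation.can_comp Q mult)
           (constellation.can_I Q mult) (constellation.can_S Q mult)
    \<and> (\<forall>s e. (s, e) \<in> constellation.can_ext Q mult \<longrightarrow>
          IS_category.S_part (constellation.can_comp Q mult)
            (constellation.can_I Q mult) (constellation.can_S Q mult) (s, e)
              = (s, constellation.R Q mult s)
        \<and> IS_category.I_part (constellation.can_comp Q mult)
            (constellation.can_I Q mult) (constellation.can_S Q mult) (s, e)
              = (constellation.R Q mult s, e))"
proof -
  interpret constellation_with_range Q mult by fact
  show ?thesis
    using can.IS_category_axioms
    by (simp add: can.S_part_def can.I_part_def can_factorisation)
qed

end
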